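(* Let $\mathbf{Z}\sim \mathrm{P}^{\mathbf{Z}}\in\mathfrak{P}_d$ have directional distribution function $\mathbf{F}$ and directional quantile function $\mathbf{Q}=\mathbf{F}^{-1}$, and let $\boldsymbol{\theta}_{\mathrm{M}}\in\mathcal{S}^{d-1}$ be the directional median (pole) selected for $\mathrm{P}^{\mathbf{Z}}$. Let $\mathcal{C}_\tau$ and $\mathbb{C}_\tau$, $\tau\in[0,1]$, be the corresponding quantile contours and quantile regions. Then: (i) $\mathbf{F}$ entirely characterizes $\mathrm{P}^{\mathbf{Z}}$, $\mathbf{F}(\mathbf{Z})\sim \mathbf{F}\#\mathrm{P}^{\mathbf{Z}}=\mathrm{P}^{\mathbf{U}}$, and $F_*\big((\mathbf{F}(\mathbf{Z}))^\top\mathbf{F}(\boldsymbol{\theta}_{\mathrm{M}})\big)$ is uniformly distributed over $[0,1]$; (ii) $\mathbf{Q}$ entirely characterizes $\mathrm{P}^{\mathbf{Z}}$, and, for $\mathbf{U}\sim\mathrm{P}^{\mathbf{U}}$, $\mathbf{Q}(\mathbf{U})\sim\mathbf{Q}\#\mathrm{P}^{\mathbf{U}}=\mathrm{P}^{\mathbf{Z}}$; (iii) the quantile contours $\mathcal{C}_\tau$, $\tau\in[0,1]$, are continuous; the quantile regions $\mathbb{C}_\tau$ are closed, connected, and nested; their intersection $\bigcap_{\tau\in[0,1]}\mathbb{C}_\tau$ is (the singleton consisting of) the directional median $\boldsymbol{\theta}_{\mathrm{M}}$; (iv) the probability content $\mathrm{P}^{\mathbf{Z}}(\mathbb{C}_\tau)$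 of $\mathbb{C}_\tau$ is $\tau$ for every $\tau\in[0,1]$, irrespective of $\mathrm{P}^{\mathbf{Z}}\in\mathfrak{P}_d$.
   Context: Let $d\ge 2$ and $\mathcal{S}^{d-1}=\{\mathbf{x}\in\mathbb{R}^d:\|\mathbf{x}\|=1\}$, equipped with its Borel $\sigma$-field and the surface area measure $\lambda^{d-1}$. Let $c(\mathbf{y},\mathbf{z})=\tfrac12 d(\mathbf{y},\mathbf{z})^2$ with $d(\mathbf{y},\mathbf{z})=\arccos(\mathbf{y}^\top\mathbf{z})$. $\mathfrak{P}_d$ is the family of probability measures on $\mathcal{S}^{d-1}$ that are absolutely continuous with respect to $\lambda^{d-1}$ with densities bounded away from zero and infinity. $\mathrm{P}^{\mathbf{U}}$ is the uniform probability measure on $\mathcal{S}^{d-1}$, and $\mathbf{S}\#\mathrm{P}$ denotes the push-forward of $\mathrm{P}$ by $\mathbf{S}$. For $\mathrm{P}^{\mathbf{Z}}\in\mathfrak{P}_d$, the directional distribution function $\mathbf{F}$ of $\mathrm{P}^{\mathbf{Z}}$ is the $\mathrm{P}^{\mathbf{Z}}$-a.s. unique minimizer of $\int c(\mathbf{z},\mathbf{S}(\mathbf{z}))\,\mathrm{d}\mathrm{P}^{\mathbf{Z}}(\mathbf{z})$ among measurable $\mathbf{S}:\mathcal{S}^{d-1}\to\mathcal{S}^{d-1}$ with $\mathbf{S}\#\mathrm{P}^{\mathbf{Z}}=\mathrm{P}^{\mathbf{U}}$; it is taken in its version that is a homeomorphism of $\mathcal{S}^{d-1}$, and the directional quantile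 function is $\mathbf{Q}=\mathbf{F}^{-1}$. The pole $\boldsymbol{\theta}_{\mathrm{M}}\in\mathcal{S}^{d-1}$ is a directional median that has been selected for $\mathrm{P}^{\mathbf{Z}}$; possible choices are a Fréchet mean, i.e. a minimizer over $\mathbf{z}\in\mathcal{S}^{d-1}$ of $\mathrm{E}_{\mathrm{P}^{\mathbf{Z}}}[c(\mathbf{Z},\mathbf{z})]$, or a minimizer over $\mathbf{z}\in\mathcal{S}^{d-1}$ of $\mathrm{P}^{\mathbf{U}}(\mathbf{Q}(\mathcal{H}_{\mathbf{z}}))$, where $\mathcal{H}_{\mathbf{z}}=\{\mathbf{u}\in\mathcal{S}^{d-1}:\mathbf{u}^\top\mathbf{F}(\mathbf{z})\ge 0\}$. Define $$F_*(u)=\frac{\int_{-1}^u(1-s^2)^{(d-3)/2}\,\mathrm{d}s}{\int_{-1}^1(1-s^2)^{(d-3)/2}\,\mathrm{d}s},\quad -1\le u\le 1.$$ For $\tau\in[0,1]$ let $\mathcal{C}^{\mathbf{U}}_\tau=\{\mathbf{u}\in\mathcal{S}^{d-1}:F_*(\mathbf{u}^\top\mathbf{F}(\boldsymbol{\theta}_{\mathrm{M}}))=1-\tau\}$ (a $(d-2)$-sphere) and $\mathbb{C}^{\mathbf{U}}_\tau=\{\mathbf{u}\in\mathcal{S}^{d-1}:F_*(\mathbf{u}^\top\mathbf{F}(\boldsymbol{\theta}_{\mathrm{M}}))\ge 1-\tau\}$. The quantile contour and quantile region of order $\tau$ of $\mathrm{P}^{\mathbf{Z}}$ are $$\mathcal{C}_\tau=\mathbf{Q}(\mathcal{C}^{\mathbf{U}}_\tau)=\{\mathbf{z}:F_*(\mathbf{F}(\mathbf{z})^\top\mathbf{F}(\boldsymbol{\theta}_{\mathrm{M}}))=1-\tau\},\qquad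 \mathbb{C}_\tau=\mathbf{Q}(\mathbb{C}^{\mathbf{U}}_\tau)=\{\mathbf{z}:F_*(\mathbf{F}(\mathbf{z})^\top\mathbf{F}(\boldsymbol{\theta}_{\mathrm{M}}))\ge 1-\tau\}.$$ "Characterizes $\mathrm{P}^{\mathbf{Z}}$" means that two members of $\mathfrak{P}_d$ with the same $\mathbf{F}$ (respectively $\mathbf{Q}$) coincide. "Nested" means $\mathbb{C}_\tau\subseteq\mathbb{C}_{\tau'}$ for $\tau\le\tau'$. A contour is called continuous in the sense that it is the image of the sphere $\mathcal{C}^{\mathbf{U}}_\tau$ by a continuous map. *)

theory Defs
  imports "HOL-Probability.Probability"
begin

abbreviation usphere :: "(real^'n) set" where
  "usphere \<equiv> sphere 0 1"

definition sphere_borel :: "(real^'n) measure" where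
  "sphere_borel = restrict_space borel usphere"

(* Surface area as cone measure: d times the Lebesgue measure of the cone over A in the unit ball;
   see lemma emeasure_sphere_area. *)
definition sphere_area :: "(real^'n) measure" where
  "sphere_area = scale_measure (of_nat CARD('n))
     (distr (restrict_space lborel (cball 0 1 - {0})) sphere_borel (\<lambda>x. x /\<^sub>R norm x))"

definition uniform_sphere :: "(real^'n) measure" where
  "uniform_sphere = uniform_measure sphere_area usphere"

definition has_law :: "'a measure \<Rightarrow> 'b measure \<Rightarrow> ('a \<Rightarrow> 'b) \<Rightarrow> 'b measure \<Rightarrow> bool" where
  "has_law M N X \<mu> \<longleftrightarrow> X \<in> measurable M N \<and> distr M N X = \<mu>"

definition bounded_density_measures :: "(real^'n) measure set" where
  "bounded_density_measures = {P. prob_space P \<and>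
     (\<exists>f\<in>borel_measurable sphere_borel. \<exists>a b. 0 < a \<and> (\<forall>z\<in>usphere. a \<le> f z \<and> f z \<le> b) \<and>
        P = density sphere_area (\<lambda>z. ennreal (f z)))}"

definition geodesic_dist :: "real^'n \<Rightarrow> real^'n \<Rightarrow> real" where
  "geodesic_dist y z = arccos (y \<bullet> z)"

definition transport_cost :: "real^'n \<Rightarrow> real^'n \<Rightarrow> real" where
  "transport_cost y z = (geodesic_dist y z)\<^sup>2 / 2"

definition optimal_map :: "(real^'n) measure \<Rightarrow> (real^'n \<Rightarrow> real^'n) \<Rightarrow> bool" where
  "optimal_map P F \<longleftrightarrow> has_law P sphere_borel F uniform_sphere \<and>
     (\<forall>S. has_law P sphere_borel S uniform_sphere \<longrightarrow>
        (\<integral>z. transport_cost z (F z) \<partial>P) \<le> (\<integral>z. transport_cost z (S z) \<partial>P))"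

(* A predicate rather than a function of P, since the existence of F is a separate theorem.
   Only the values of F on the sphere matter. *)
definition directional_distribution_function ::
    "(real^'n) measure \<Rightarrow> (real^'n \<Rightarrow> real^'n) \<Rightarrow> bool" where
  "directional_distribution_function P F \<longleftrightarrow>
     optimal_map P F \<and> (\<forall>S. optimal_map P S \<longrightarrow> (AE z in P. S z = F z)) \<and>
     (\<exists>G. homeomorphism usphere usphere F G)"

definition directional_quantile :: "(real^'n \<Rightarrow> real^'n) \<Rightarrow> real^'n \<Rightarrow> real^'n" where
  "directional_quantile F = inv_into usphere F"

(* For d = 2, 3 the value of powr at base 0 is irrelevant: s = 1 and s = -1 form a null set. *)
definition F_star :: "nat \<Rightarrow> real \<Rightarrow> real" where
  "F_star d u = (LBINT s:{-1..u}. (1 - s\<^sup>2) powr ((real d - 3) / 2)) /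
                (LBINT s:{-1..1}. (1 - s\<^sup>2) powr ((real d - 3) / 2))"

(* In what follows the pole \<theta> is a point of the sphere, whichever notion of directional median
   (Frechet mean, deepest point, ...) was used to select it. *)
definition uniform_contour :: "(real^'n \<Rightarrow> real^'n) \<Rightarrow> real^'n \<Rightarrow> real \<Rightarrow> (real^'n) set" where
  "uniform_contour F \<theta> \<tau> = {u \<in> usphere. F_star CARD('n) (u \<bullet> F \<theta>) = 1 - \<tau>}"

definition uniform_region :: "(real^'n \<Rightarrow> real^'n) \<Rightarrow> real^'n \<Rightarrow> real \<Rightarrow> (real^'n) set" where
  "uniform_region F \<theta> \<tau> = {u \<in> usphere. F_star CARD('n) (u \<bullet> F \<theta>) \<ge> 1 - \<tau>}"

definition quantile_contour :: "(real^'n \<Rightarrow> real^'n) \<Rightarrow> real^'n \<Rightarrow> real \<Rightarrow> (real^'n) set" where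
  "quantile_contour F \<theta> \<tau> = directional_quantile F ` uniform_contour F \<theta> \<tau>"

definition quantile_region :: "(real^'n \<Rightarrow> real^'n) \<Rightarrow> real^'n \<Rightarrow> real \<Rightarrow> (real^'n) set" where
  "quantile_region F \<theta> \<tau> = directional_quantile F ` uniform_region F \<theta> \<tau>"

lemma emeasure_sphere_area:
  fixes A :: "(real^'n) set"
  assumes A: "A \<in> sets sphere_borel"
  shows "emeasure sphere_area A =
    of_nat CARD('n) * emeasure lborel {r *\<^sub>R x | r x. 0 < r \<and> r \<le> 1 \<and> x \<in> A}"
proof -
  have sub: "A \<subseteq> usphere"
    using sets.sets_into_space[OF A] by (simp add: sphere_borel_def space_restrict_space)
  have meas: "(\<lambda>x::real^'n. x /\<^sub>R norm x)
      \<in> measurable (restrict_space lborel (cball 0 1 - {0})) sphere_borel"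
    unfolding sphere_borel_def
    by (rule measurable_restrict_space2) (auto simp: space_restrict_space intro!: measurable_restrict_space1)
  have "(\<lambda>x. x /\<^sub>R norm x) -` A \<inter> (cball 0 1 - {0}) = {r *\<^sub>R x | r x. 0 < r \<and> r \<le> 1 \<and> x \<in> A}"
    (is "?L = ?R")
  proof
    show "?L \<subseteq> ?R"
    proof
      fix y assume "y \<in> ?L"
      then have "y = norm y *\<^sub>R (y /\<^sub>R norm y)" "0 < norm y" "norm y \<le> 1" "y /\<^sub>R norm y \<in> A"
        by auto
      then show "y \<in> ?R" by blast
    qed
    show "?R \<subseteq> ?L" using sub by (auto simp: subset_iff)
  qed
  moreover have "?R \<subseteq> cball 0 1 - {0}"
    using sub by (auto simp: subset_iff)
  ultimately have "emeasure (restrict_space lborel (cball 0 1 - {0})) ?L = emeasure lborel ?R"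
    by (simp add: emeasure_restrict_space)
  then show ?thesis
    using A meas by (simp add: sphere_area_def emeasure_distr space_restrict_space)
qed

lemma prob_space_uniform_sphere: "prob_space (uniform_sphere :: (real^'n) measure)"
proof -
  have S: "(usphere :: (real^'n) set) \<in> sets sphere_borel"
    using sets.top[of "sphere_borel :: (real^'n) measure"]
    by (simp add: sphere_borel_def space_restrict_space)
  have "y \<in> {r *\<^sub>R x | r x. 0 < r \<and> r \<le> 1 \<and> x \<in> usphere}"
    if "y \<in> cball 0 1 - {0}" for y :: "real^'n"
  proof -
    have "y = norm y *\<^sub>R (y /\<^sub>R norm y)" "0 < norm y" "norm y \<le> 1" "y /\<^sub>R norm y \<in> usphere"
      using that by auto
    then show ?thesis by blast
  qed
  then have "{r *\<^sub>R x | r x. 0 < r \<and> r \<le> 1 \<and> x \<in> usphere} = (cball 0 1 - {0} :: (real^'n) set)"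
    by (auto simp: subset_iff)
  moreover have "emeasure lborel (cball 0 1 - {0} :: (real^'n) set) = emeasure lborel (cball 0 1 :: (real^'n) set)"
    by (rule emeasure_Diff_null_set) (auto intro: null_setsI)
  moreover have "emeasure lborel (cball 0 1 :: (real^'n) set) = ennreal (measure lborel (cball 0 1 :: (real^'n) set))"
    using emeasure_lborel_cball_finite[of "0::real^'n" 1] by (intro emeasure_eq_ennreal_measure) auto
  moreover have "measure lborel (cball 0 1 :: (real^'n) set) > 0"
    by (rule content_cball_pos) simp
  ultimately have "emeasure sphere_area (usphere :: (real^'n) set) \<noteq> 0"
    "emeasure sphere_area (usphere :: (real^'n) set) \<noteq> \<infinity>"
    using emeasure_sphere_area[OF S]
    by (auto simp: ennreal_mult_eq_top_iff)
  then show ?thesis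
    unfolding uniform_sphere_def by (rule prob_space_uniform_measure)
qed

lemma directional_quantile_homeomorphism:
  assumes "directional_distribution_function P F"
  shows "homeomorphism usphere usphere F (directional_quantile F)"
proof -
  obtain G where G: "homeomorphism usphere usphere F G"
    using assms unfolding directional_distribution_function_def by blast
  then have GF: "\<And>z. z \<in> usphere \<Longrightarrow> G (F z) = z" and im: "F ` usphere = usphere"
    by (auto simp: homeomorphism_def)
  from GF have inj: "inj_on F usphere"
    by (rule inj_on_inverseI)
  have eq: "G u = directional_quantile F u" if "u \<in> usphere" for u
  proof -
    from that im obtain z where z: "z \<in> usphere" "u = F z"
      by blast
    show ?thesis
      unfolding z(2) GF[OF z(1)] directional_quantile_def inv_into_f_f[OF inj z(1)] ..
  qed
  show ?thesis
    by (rule homeomorphism_cong[OF G refl refl refl eq[symmetric]])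
qed

lemma quantile_contour_eq:
  fixes F :: "real^'n \<Rightarrow> real^'n"
  assumes "directional_distribution_function P F"
  shows "quantile_contour F \<theta> \<tau> = {z \<in> usphere. F_star CARD('n) (F z \<bullet> F \<theta>) = 1 - \<tau>}"
proof -
  note h = directional_quantile_homeomorphism[OF assms]
  have "u \<in> usphere \<Longrightarrow> directional_quantile F u \<in> usphere \<and> F (directional_quantile F u) = u"
       "z \<in> usphere \<Longrightarrow> F z \<in> usphere \<and> directional_quantile F (F z) = z" for u z
    using h unfolding homeomorphism_def by blast+
  then show ?thesis
    unfolding quantile_contour_def uniform_contour_def by (fastforce simp: image_iff)
qed

lemma quantile_region_eq:
  fixes F :: "real^'n \<Rightarrow> real^'n"
  assumes "directional_distribution_function P F"
  shows "quantile_region F \<theta> \<tau> = {z \<in> usphere. F_star CARD('n) (F z \<bullet> F \<theta>) \<ge> 1 - \<tau>}"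
proof -
  note h = directional_quantile_homeomorphism[OF assms]
  have "u \<in> usphere \<Longrightarrow> directional_quantile F u \<in> usphere \<and> F (directional_quantile F u) = u"
       "z \<in> usphere \<Longrightarrow> F z \<in> usphere \<and> directional_quantile F (F z) = z" for u z
    using h unfolding homeomorphism_def by blast+
  then show ?thesis
    unfolding quantile_region_def uniform_region_def by (fastforce simp: image_iff)
qed

end

theory Submission
  imports Defs
begin

text \<open>Everything rests on one fact about the uniform law on the sphere: for a unit vector \<open>e\<close>, the function
\<open>F_star\<close> is the distribution function of \<open>u \<bullet> e\<close> (\<open>measure_uniform_sphere_halfspace\<close>). Since surface area is cone measure,
this amounts to computing the volume of \<open>{x \<in> cball 0 1. x \<bullet> e < t * norm x}\<close>. A rotation makes \<open>e\<close> a
coordinate vector (\<open>lborel_distr_orthogonal_transformation\<close>). Write \<open>h\<close> for \<open>x \<bullet> e\<close>, let \<open>r\<close> be the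
distance of \<open>x\<close> from the axis, and substitute \<open>h = r * s\<close>. The condition \<open>norm x \<le> 1\<close> becomes
\<open>r \<le> 1 / sqrt (1 + s\<^sup>2)\<close> and the other one a condition on \<open>s\<close> alone, so integrating over the orthogonal
hyperplane first leaves a constant times the integral of \<open>(1 / sqrt (1 + s\<^sup>2)) ^ d\<close>
(\<open>emeasure_ball_cone_Basis\<close>). The further substitution \<open>s = u / sqrt (1 - u\<^sup>2)\<close> yields the weight in the
definition of \<open>F_star\<close> (\<open>nn_integral_cotangent_substitution\<close>). The constant disappears on division by the
volume of the ball.

Hence \<open>F_star\<close> transforms \<open>u \<bullet> e\<close> into a uniform variable on \<open>{0..1}\<close>
(\<open>uniform_sphere_F_star_uniform\<close>). As \<open>F\<close> pushes \<open>P\<close> to the uniform law, the same holds for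
\<open>F z \<bullet> F \<theta>\<close> under \<open>P\<close>; this gives the probability content of the quantile regions. The quantile function
pushes the uniform law back to \<open>P\<close> (\<open>has_law_directional_quantile\<close>), hence \<open>P\<close> is determined by either
function.

The topological claims are transported by the homeomorphism from the sphere with its uniform law, where the
regions are spherical caps about \<open>F \<theta>\<close>. These are compact, and connected because meridian arcs join their points
to the pole (\<open>connected_spherical_cap\<close>). The smallest of them, of order zero, is \<open>{F \<theta>}\<close>.\<close>

section \<open>Rotation invariance and integrals over balls\<close>

lemma nn_integral_lborel_shift:
  fixes c :: "'a::euclidean_space"
  assumes "g \<in> borel_measurable borel"
  shows "(\<integral>\<^sup>+x. g x \<partial>lborel) = (\<integral>\<^sup>+x. g (x + c) \<partial>lborel)"
proof -
  have "(\<integral>\<^sup>+x. g x \<partial>lborel) = (\<integral>\<^sup>+x. g x \<partial>distr lborel borel ((+) c))"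
    by (simp add: lborel_distr_plus)
  also have "\<dots> = (\<integral>\<^sup>+x. g (x + c) \<partial>lborel)"
    using assms by (subst nn_integral_distr) (auto simp: add.commute)
  finally show ?thesis .
qed

text \<open>Uniqueness of Haar measure, in the form needed here. The pushforward of \<open>lborel\<close> by \<open>f\<close> is again
translation invariant. Integrating \<open>indicator A (f x) * indicator B (y - f x)\<close> over \<open>x\<close> and \<open>y\<close> in the
two possible orders gives \<open>\<mu>' A * \<mu> B = \<mu> A * \<mu> B\<close>, where \<open>\<mu>\<close> is \<open>lborel\<close>, \<open>\<mu>'\<close> the pushforward and
\<open>B\<close> the unit ball, which \<open>f\<close> and reflection in the origin preserve and which has positive finite volume.\<close>

lemma lborel_distr_orthogonal_transformation:
  fixes f :: "'a::euclidean_space \<Rightarrow> 'a"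
  assumes f: "orthogonal_transformation f"
  shows "distr lborel borel f = lborel"
proof (rule measure_eqI)
  have lin: "linear f" and nrm: "\<And>x. norm (f x) = norm x"
    using f by (auto simp: orthogonal_transformation)
  have [measurable]: "f \<in> borel_measurable borel"
    by (intro borel_measurable_continuous_onI linear_continuous_on linear_conv_bounded_linear[THEN iffD1] lin)
  obtain g where g: "\<And>y. f (g y) = y"
    using orthogonal_transformation_surj[OF f] by (metis surj_def)
  show "sets (distr lborel borel f) = sets lborel" by simp
  fix A assume "A \<in> sets (distr lborel borel f)"
  then have [measurable]: "A \<in> sets borel" by simp
  let ?B = "cball 0 1 :: 'a set"
  have [measurable]: "?B \<in> sets borel" by simp
  let ?\<mu> = "emeasure (lborel :: 'a measure)"
  have "emeasure (distr lborel borel f) A * ?\<mu> ?B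
      = (\<integral>\<^sup>+x. indicator A (f x) \<partial>lborel) * (\<integral>\<^sup>+y. indicator ?B y \<partial>lborel)"
    by (subst nn_integral_distr[of f lborel borel "indicator A", symmetric]) auto
  also have "\<dots> = (\<integral>\<^sup>+x. indicator A (f x) * (\<integral>\<^sup>+y. indicator ?B (y + - f x) \<partial>lborel) \<partial>lborel)"
  proof (subst nn_integral_multc[symmetric])
    have "(\<integral>\<^sup>+y. indicator ?B y \<partial>lborel) = (\<integral>\<^sup>+y. indicator ?B (y + - f x) \<partial>lborel)" for x
      by (rule nn_integral_lborel_shift) measurable
    then show "(\<integral>\<^sup>+x. indicator A (f x) * (\<integral>\<^sup>+y. indicator ?B y \<partial>lborel) \<partial>lborel)
      = (\<integral>\<^sup>+x. indicator A (f x) * (\<integral>\<^sup>+y. indicator ?B (y + - f x) \<partial>lborel) \<partial>lborel)"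
      by (intro nn_integral_cong) simp
  qed measurable
  also have "\<dots> = (\<integral>\<^sup>+x. (\<integral>\<^sup>+y. indicator A (f x) * indicator ?B (y - f x) \<partial>lborel) \<partial>lborel)"
    by (subst nn_integral_cmult) auto
  also have "\<dots> = (\<integral>\<^sup>+y. (\<integral>\<^sup>+x. indicator A (f x) * indicator ?B (y - f x) \<partial>lborel) \<partial>lborel)"
    by (rule lborel_pair.Fubini') measurable
  also have "\<dots> = (\<integral>\<^sup>+y. (\<integral>\<^sup>+x. indicator A (f x + y) * indicator ?B x \<partial>lborel) \<partial>lborel)"
  proof (rule nn_integral_cong)
    fix y
    \<comment> \<open>Shifting by the preimage of \<open>y\<close> moves \<open>y\<close> from the ball to \<open>A\<close> and leaves \<open>indicator ?B (- f x)\<close>.\<close>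
    have "(\<integral>\<^sup>+x. indicator A (f x) * indicator ?B (y - f x) \<partial>lborel)
        = (\<integral>\<^sup>+x. indicator A (f (x + g y)) * indicator ?B (y - f (x + g y)) \<partial>lborel)"
      by (rule nn_integral_lborel_shift) measurable
    also have "\<dots> = (\<integral>\<^sup>+x. indicator A (f x + y) * indicator ?B x \<partial>lborel)"
      by (intro nn_integral_cong) (simp add: linear_add[OF lin] g nrm indicator_def)
    finally show "(\<integral>\<^sup>+x. indicator A (f x) * indicator ?B (y - f x) \<partial>lborel)
        = (\<integral>\<^sup>+x. indicator A (f x + y) * indicator ?B x \<partial>(lborel :: 'a measure))" .
  qed
  also have "\<dots> = (\<integral>\<^sup>+x. (\<integral>\<^sup>+y. indicator A (f x + y) * indicator ?B x \<partial>lborel) \<partial>lborel)"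
    by (rule lborel_pair.Fubini') measurable
  also have "\<dots> = (\<integral>\<^sup>+x. (\<integral>\<^sup>+y. indicator A (y + f x) \<partial>lborel) * indicator ?B x \<partial>lborel)"
    by (subst nn_integral_multc) (auto simp: add.commute)
  also have "\<dots> = (\<integral>\<^sup>+x. ?\<mu> A * indicator ?B x \<partial>lborel)"
    by (subst nn_integral_lborel_shift[where g = "indicator A", symmetric]) auto
  also have "\<dots> = ?\<mu> A * ?\<mu> ?B"
    by (subst nn_integral_cmult) auto
  finally have eq: "emeasure (distr lborel borel f) A * ?\<mu> ?B = ?\<mu> A * ?\<mu> ?B" .
  have "?\<mu> ?B = ennreal (unit_ball_vol (real DIM('a)))"
    by (simp add: emeasure_cball)
  moreover have "unit_ball_vol (real DIM('a)) > 0"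
    by (rule unit_ball_vol_pos) simp
  ultimately have "?\<mu> ?B \<noteq> 0" "?\<mu> ?B \<noteq> \<top>"
    by (metis ennreal_eq_0_iff linorder_not_le, simp)
  then show "emeasure (distr lborel borel f) A = ?\<mu> A"
    using eq by (simp add: mult.commute[of _ "?\<mu> ?B"] ennreal_mult_cancel_left)
qed

text \<open>The norm is integrated by layers: writing it as the length of \<open>{0<..<R f}\<close> and exchanging the
integrals leaves volumes of spherical shells, which grow like the power \<open>card A\<close> of the radius.
The point of the lemma is homogeneity: the result is a constant times \<open>\<rho> ^ (card A + 1)\<close>.\<close>

lemma nn_integral_norm_over_ball_PiM:
  fixes A :: "'i set" and \<rho> :: real
  defines "R \<equiv> \<lambda>f. sqrt (\<Sum>i\<in>A. (f i)\<^sup>2)" and "m \<equiv> card A"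
  assumes A: "finite A" and \<rho>: "0 < \<rho>"
  shows "(\<integral>\<^sup>+f. ennreal (R f) * indicator {f. R f \<le> \<rho>} f \<partial>(\<Pi>\<^sub>M i\<in>A. lborel))
    = ennreal (unit_ball_vol m * m / (m + 1) * \<rho> ^ (m + 1))"
proof -
  let ?M = "\<Pi>\<^sub>M i\<in>A. (lborel :: real measure)" and ?\<kappa> = "unit_ball_vol (real m)"
  interpret P: product_sigma_finite "\<lambda>_::'i. lborel :: real measure" ..
  interpret pair_sigma_finite ?M "lborel :: real measure"
    using P.sigma_finite[OF A] by (intro pair_sigma_finite.intro) (auto simp: sigma_finite_lborel)
  have [measurable]: "R \<in> borel_measurable ?M"
    unfolding R_def by measurable
  have R0: "R f \<ge> 0" for f by (simp add: R_def sum_nonneg)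
  have ball: "emeasure ?M {f \<in> space ?M. R f \<le> r} = ennreal (?\<kappa> * r ^ m)" if "r > 0" for r
  proof -
    have "{f \<in> space ?M. R f \<le> r} = {f. sqrt (\<Sum>i\<in>A. (f i)\<^sup>2) \<le> r} \<inter> space ?M"
      by (auto simp: R_def)
    then show ?thesis using emeasure_cball_aux[OF A that] by (simp add: m_def)
  qed
  have "(\<integral>\<^sup>+f. ennreal (R f) * indicator {f. R f \<le> \<rho>} f \<partial>?M)
      = (\<integral>\<^sup>+f. (\<integral>\<^sup>+r. indicator {(f, r). 0 < r \<and> r < R f \<and> R f \<le> \<rho>} (f, r) \<partial>lborel) \<partial>?M)"
  proof (rule nn_integral_cong)
    fix f
    have "(\<integral>\<^sup>+r. indicator {(f, r). 0 < r \<and> r < R f \<and> R f \<le> \<rho>} (f, r) \<partial>lborel)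
        = (\<integral>\<^sup>+r. indicator {0<..<R f} r * indicator {f. R f \<le> \<rho>} f \<partial>lborel)"
      by (intro nn_integral_cong) (auto simp: indicator_def)
    also have "\<dots> = ennreal (R f) * indicator {f. R f \<le> \<rho>} f"
      using R0 by (subst nn_integral_multc) (auto)
    finally show "ennreal (R f) * indicator {f. R f \<le> \<rho>} f =
      (\<integral>\<^sup>+r. indicator {(f, r). 0 < r \<and> r < R f \<and> R f \<le> \<rho>} (f, r) \<partial>lborel)" ..
  qed
  also have "\<dots> = (\<integral>\<^sup>+r. (\<integral>\<^sup>+f. indicator {(f, r). 0 < r \<and> r < R f \<and> R f \<le> \<rho>} (f, r) \<partial>?M) \<partial>lborel)"
    by (rule Fubini'[symmetric]) measurable
  also have "\<dots> = (\<integral>\<^sup>+r. ennreal (?\<kappa> * (\<rho> ^ m - r ^ m)) * indicator {0..\<rho>} r \<partial>lborel)"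
  proof (rule nn_integral_cong_AE)
    \<comment> \<open>At \<open>r = 0\<close> the condition \<open>0 < r\<close> makes the left side vanish, while the right side need not.\<close>
    have "(\<integral>\<^sup>+f. indicator {(f, r). 0 < r \<and> r < R f \<and> R f \<le> \<rho>} (f, r) \<partial>?M)
        = ennreal (?\<kappa> * (\<rho> ^ m - r ^ m)) * indicator {0..\<rho>} r" if "r \<noteq> 0" for r
    proof (cases "0 < r \<and> r \<le> \<rho>")
      case True
      have "(\<integral>\<^sup>+f. indicator {(f, r). 0 < r \<and> r < R f \<and> R f \<le> \<rho>} (f, r) \<partial>?M)
        = (\<integral>\<^sup>+f. indicator ({f \<in> space ?M. R f \<le> \<rho>} - {f \<in> space ?M. R f \<le> r}) f \<partial>?M)"
        using True by (intro nn_integral_cong) (auto simp: indicator_def)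
      also have "\<dots> = emeasure ?M ({f \<in> space ?M. R f \<le> \<rho>} - {f \<in> space ?M. R f \<le> r})"
        by (rule nn_integral_indicator) measurable
      also have "\<dots> = ennreal (?\<kappa> * \<rho> ^ m) - ennreal (?\<kappa> * r ^ m)"
        using True \<rho> by (subst emeasure_Diff) (auto simp: ball)
      also have "\<dots> = ennreal (?\<kappa> * (\<rho> ^ m - r ^ m))"
        using True by (subst ennreal_minus) (auto simp: algebra_simps)
      finally show ?thesis using True by simp
    next
      case False
      with that have "indicator {(f, r). 0 < r \<and> r < R f \<and> R f \<le> \<rho>} (f, r) = (0::ennreal)"
          "indicator {0..\<rho>} r = (0::ennreal)" for f
        by (auto simp: indicator_def)
      then show ?thesis by (simp del: indicator_simps)
    qed
    then show "AE r in lborel. (\<integral>\<^sup>+f. indicator {(f, r). 0 < r \<and> r < R f \<and> R f \<le> \<rho>} (f, r) \<partial>?M)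
        = ennreal (?\<kappa> * (\<rho> ^ m - r ^ m)) * indicator {0..\<rho>} r"
      using AE_lborel_singleton[of 0] by (auto elim: AE_mp)
  qed
  also have "\<dots> = ennreal (?\<kappa> * (\<rho> ^ m * \<rho> - \<rho> ^ (m + 1) / (m + 1)) - ?\<kappa> * (\<rho> ^ m * 0 - 0 ^ (m + 1) / (m + 1)))"
  proof (rule nn_integral_FTC_Icc[where F = "\<lambda>r. ?\<kappa> * (\<rho> ^ m * r - r ^ (m + 1) / (m + 1))"])
    show "(\<lambda>r. ?\<kappa> * (\<rho> ^ m - r ^ m)) \<in> borel_measurable borel" by measurable
    fix r assume r: "r \<in> {0..\<rho>}"
    show "((\<lambda>r. ?\<kappa> * (\<rho> ^ m * r - r ^ (m + 1) / (m + 1))) has_real_derivative ?\<kappa> * (\<rho> ^ m - r ^ m)) (at r)"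
      by (auto intro!: derivative_eq_intros simp del: power_Suc)
    show "0 \<le> ?\<kappa> * (\<rho> ^ m - r ^ m)"
      using r by (auto intro!: mult_nonneg_nonneg power_mono)
  qed (use \<rho> in auto)
  also have "?\<kappa> * (\<rho> ^ m * \<rho> - \<rho> ^ (m + 1) / (m + 1)) - ?\<kappa> * (\<rho> ^ m * 0 - 0 ^ (m + 1) / (m + 1)) = ?\<kappa> * m / (m + 1) * \<rho> ^ (m + 1)"
    by (simp add: field_simps)
  finally show ?thesis by simp
qed

section \<open>Volume of a cone in the ball\<close>

text \<open>On the line through a point at distance \<open>r\<close> from the axis, the height \<open>h\<close> is measured in units of \<open>r\<close>.
In the new variable \<open>s = h / r\<close>, the cotangent of the angle with the axis, the conical condition
no longer involves \<open>r\<close>.\<close>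

lemma nn_integral_ball_slice_rescale:
  fixes r t :: real
  assumes r: "r > 0"
  shows "(\<integral>\<^sup>+h. indicator {h. h\<^sup>2 + r\<^sup>2 \<le> 1 \<and> h < t * sqrt (h\<^sup>2 + r\<^sup>2)} h \<partial>lborel)
    = ennreal r * (\<integral>\<^sup>+s. indicator {s. r \<le> 1 / sqrt (1 + s\<^sup>2) \<and> s < t * sqrt (1 + s\<^sup>2)} s \<partial>lborel)"
proof -
  have "(\<integral>\<^sup>+h. indicator {h. h\<^sup>2 + r\<^sup>2 \<le> 1 \<and> h < t * sqrt (h\<^sup>2 + r\<^sup>2)} h \<partial>lborel)
    = ennreal r * (\<integral>\<^sup>+s. indicator {h. h\<^sup>2 + r\<^sup>2 \<le> 1 \<and> h < t * sqrt (h\<^sup>2 + r\<^sup>2)} (0 + r * s) \<partial>lborel)"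
    using r by (subst nn_integral_real_affine[of _ r 0]) auto
  moreover have "(r * s)\<^sup>2 + r\<^sup>2 \<le> 1 \<and> r * s < t * sqrt ((r * s)\<^sup>2 + r\<^sup>2)
      \<longleftrightarrow> r \<le> 1 / sqrt (1 + s\<^sup>2) \<and> s < t * sqrt (1 + s\<^sup>2)" for s
  proof -
    have q: "sqrt ((r * s)\<^sup>2 + r\<^sup>2) = r * sqrt (1 + s\<^sup>2)"
    proof -
      have "(r * s)\<^sup>2 + r\<^sup>2 = r\<^sup>2 * (1 + s\<^sup>2)" by (simp add: power_mult_distrib algebra_simps)
      then show ?thesis using r by (simp add: real_sqrt_mult)
    qed
    have pos: "sqrt (1 + s\<^sup>2) > 0" by (simp add: add_pos_nonneg)
    have "(r * s)\<^sup>2 + r\<^sup>2 \<le> 1 \<longleftrightarrow> r * sqrt (1 + s\<^sup>2) \<le> 1"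
      unfolding q[symmetric] by simp
    also have "\<dots> \<longleftrightarrow> r \<le> 1 / sqrt (1 + s\<^sup>2)"
      using pos by (simp add: field_simps)
    finally have 1: "(r * s)\<^sup>2 + r\<^sup>2 \<le> 1 \<longleftrightarrow> r \<le> 1 / sqrt (1 + s\<^sup>2)" .
    have "r * s < t * sqrt ((r * s)\<^sup>2 + r\<^sup>2) \<longleftrightarrow> r * s < r * (t * sqrt (1 + s\<^sup>2))"
      unfolding q by (simp add: mult_ac)
    also have "\<dots> \<longleftrightarrow> s < t * sqrt (1 + s\<^sup>2)"
      using r by (rule mult_less_cancel_left_pos)
    finally show ?thesis using 1 by blast
  qed
  ultimately show ?thesis by (simp add: indicator_def)
qed

text \<open>Slicing parallel to the axis and rescaling each slice turns the volume into an integral over the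
cotangent \<open>s\<close> and over the projection of the point to the hyperplane orthogonal to \<open>b\<close>. For fixed \<open>s\<close> the
projection ranges over a ball of radius \<open>1 / sqrt (1 + s\<^sup>2)\<close> and is weighted by its norm \<open>R\<close>, the
Jacobian of the rescaling; homogeneity makes its contribution a constant times the power \<open>DIM('a)\<close> of
that radius.\<close>

lemma emeasure_ball_cone_Basis:
  fixes b :: "'a::euclidean_space" and t :: real
  defines "m \<equiv> DIM('a) - 1"
  assumes dim: "DIM('a) \<ge> 2" and b: "b \<in> Basis"
  shows "emeasure lborel {x \<in> cball 0 1. x \<bullet> b < t * norm x}
    = ennreal (unit_ball_vol m * m / (m + 1)) *
      (\<integral>\<^sup>+s. ennreal ((1 / sqrt (1 + s\<^sup>2)) ^ DIM('a)) * indicator {s. s < t * sqrt (1 + s\<^sup>2)} s \<partial>lborel)"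
proof -
  define I where "I = (Basis :: 'a set) - {b}"
  let ?M = "\<lambda>J. \<Pi>\<^sub>M i\<in>J. (lborel :: real measure)"
  have fin: "finite I" and bI: "b \<notin> I" and ins: "insert b I = Basis" and card: "card I = m"
    using b by (auto simp: I_def m_def)
  have m: "m \<noteq> 0" "m + 1 = DIM('a)" using dim by (auto simp: m_def)
  interpret P: product_sigma_finite "\<lambda>_::'a. lborel :: real measure" ..
  interpret pair_sigma_finite "?M I" "lborel :: real measure"
    using P.sigma_finite[OF fin] by (intro pair_sigma_finite.intro) (auto simp: sigma_finite_lborel)
  define R where "R f = sqrt (\<Sum>i\<in>I. (f i)\<^sup>2)" for f :: "'a \<Rightarrow> real"
  have [measurable]: "R \<in> borel_measurable (?M I)" unfolding R_def by measurable
  have R2: "(R f)\<^sup>2 = (\<Sum>i\<in>I. (f i)\<^sup>2)" for f by (simp add: R_def sum_nonneg)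
  have R0: "R f \<ge> 0" for f by (simp add: R_def sum_nonneg)
  let ?S = "{x \<in> cball 0 1. x \<bullet> b < t * norm x} :: 'a set"
  let ?C = "ennreal (unit_ball_vol m * m / (m + 1))"
  define \<rho> where "\<rho> s = 1 / sqrt (1 + s\<^sup>2)" for s :: real
  have \<rho>: "\<rho> s > 0" for s by (simp add: \<rho>_def add_pos_nonneg)
  let ?T = "{s. s < t * sqrt (1 + s\<^sup>2)}"
  have [measurable]: "?S \<in> sets borel" "?T \<in> sets borel" "\<rho> \<in> borel_measurable borel"
    unfolding \<rho>_def by measurable
  have S: "(\<Sum>i\<in>Basis. (f(b := h)) i *\<^sub>R i) \<in> ?S \<longleftrightarrow> h\<^sup>2 + (R f)\<^sup>2 \<le> 1 \<and> h < t * sqrt (h\<^sup>2 + (R f)\<^sup>2)" for f h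
  proof -
    let ?x = "\<Sum>i\<in>Basis. (f(b := h)) i *\<^sub>R i"
    have "norm ?x = sqrt (\<Sum>i\<in>Basis. (?x \<bullet> i)\<^sup>2)"
      by (subst norm_eq_sqrt_inner, subst euclidean_inner) (simp add: power2_eq_square)
    also have "(\<Sum>i\<in>Basis. (?x \<bullet> i)\<^sup>2) = (\<Sum>i\<in>Basis. ((f(b := h)) i)\<^sup>2)"
      by (intro sum.cong refl) (simp only: inner_sum_left_Basis)
    also have "\<dots> = h\<^sup>2 + (\<Sum>i\<in>I. ((f(b := h)) i)\<^sup>2)"
      unfolding ins[symmetric] using fin bI by simp
    also have "(\<Sum>i\<in>I. ((f(b := h)) i)\<^sup>2) = (R f)\<^sup>2"
      unfolding R2 using bI by (intro sum.cong refl) auto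
    finally have n: "norm ?x = sqrt (h\<^sup>2 + (R f)\<^sup>2)" .
    have "?x \<bullet> b = h" using b by (subst inner_sum_left_Basis) auto
    with n show ?thesis by (simp only: mem_Collect_eq mem_cball_0) simp
  qed
  \<comment> \<open>Points on the axis itself cannot be rescaled; in dimension at least two they are negligible.\<close>
  have null: "AE f in ?M I. R f > 0"
  proof (rule AE_I)
    show "{f \<in> space (?M I). \<not> R f > 0} \<subseteq> (\<Pi>\<^sub>E i\<in>I. {0})"
    proof
      fix f assume f: "f \<in> {f \<in> space (?M I). \<not> R f > 0}"
      then have "(\<Sum>i\<in>I. (f i)\<^sup>2) = 0" using R0[of f] R2[of f] by simp
      then have "\<forall>i\<in>I. f i = 0" using fin by (subst (asm) sum_nonneg_eq_0_iff) auto
      then show "f \<in> (\<Pi>\<^sub>E i\<in>I. {0})" using f by (auto simp: space_PiM extensional_def fun_eq_iff)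
    qed
    show "emeasure (?M I) (\<Pi>\<^sub>E i\<in>I. {0}) = 0"
      using fin m card by (subst P.emeasure_PiM) auto
    show "(\<Pi>\<^sub>E i\<in>I. {0}) \<in> sets (?M I)"
      using fin by (intro sets_PiM_I_finite) auto
  qed
  have "emeasure lborel ?S = (\<integral>\<^sup>+f. indicator ?S (\<Sum>i\<in>Basis. f i *\<^sub>R i) \<partial>?M Basis)"
    by (subst lborel_eq, subst nn_integral_indicator[symmetric], simp, subst nn_integral_distr) auto
  also have "\<dots> = (\<integral>\<^sup>+f. (\<integral>\<^sup>+h. indicator ?S (\<Sum>i\<in>Basis. (f(b := h)) i *\<^sub>R i) \<partial>lborel) \<partial>?M I)"
    unfolding ins[symmetric] using fin bI
    by (subst P.product_nn_integral_insert) (auto simp: ins)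
  also have "\<dots> = (\<integral>\<^sup>+f. (\<integral>\<^sup>+s. ennreal (R f) * indicator {f. R f \<le> \<rho> s} f * indicator ?T s \<partial>lborel) \<partial>?M I)"
  proof (rule nn_integral_cong_AE, use null in eventually_elim)
    fix f assume "R f > 0"
    have "(\<integral>\<^sup>+h. indicator ?S (\<Sum>i\<in>Basis. (f(b := h)) i *\<^sub>R i) \<partial>lborel)
       = (\<integral>\<^sup>+h. indicator {h. h\<^sup>2 + (R f)\<^sup>2 \<le> 1 \<and> h < t * sqrt (h\<^sup>2 + (R f)\<^sup>2)} h \<partial>lborel)"
      by (intro nn_integral_cong) (simp only: indicator_def S, simp)
    also have "\<dots> = ennreal (R f) * (\<integral>\<^sup>+s. indicator {s. R f \<le> \<rho> s \<and> s < t * sqrt (1 + s\<^sup>2)} s \<partial>lborel)"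
      unfolding \<rho>_def by (rule nn_integral_ball_slice_rescale) fact
    also have "\<dots> = (\<integral>\<^sup>+s. ennreal (R f) * indicator {s. R f \<le> \<rho> s \<and> s < t * sqrt (1 + s\<^sup>2)} s \<partial>lborel)"
      by (rule nn_integral_cmult[symmetric]) measurable
    also have "\<dots> = (\<integral>\<^sup>+s. ennreal (R f) * indicator {f. R f \<le> \<rho> s} f * indicator ?T s \<partial>lborel)"
      by (intro nn_integral_cong) (auto simp: indicator_def)
    finally show "(\<integral>\<^sup>+h. indicator ?S (\<Sum>i\<in>Basis. (f(b := h)) i *\<^sub>R i) \<partial>lborel)
      = (\<integral>\<^sup>+s. ennreal (R f) * indicator {f. R f \<le> \<rho> s} f * indicator ?T s \<partial>lborel)" .
  qed
  also have "\<dots> = (\<integral>\<^sup>+s. (\<integral>\<^sup>+f. ennreal (R f) * indicator {f. R f \<le> \<rho> s} f * indicator ?T s \<partial>?M I) \<partial>lborel)"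
    by (rule Fubini'[symmetric]) (simp add: case_prod_beta, measurable)
  also have "\<dots> = (\<integral>\<^sup>+s. ?C * (ennreal (\<rho> s ^ DIM('a)) * indicator ?T s) \<partial>lborel)"
  proof (rule nn_integral_cong)
    fix s
    have "(\<integral>\<^sup>+f. ennreal (R f) * indicator {f. R f \<le> \<rho> s} f * indicator ?T s \<partial>?M I)
        = (\<integral>\<^sup>+f. ennreal (R f) * indicator {f. R f \<le> \<rho> s} f \<partial>?M I) * indicator ?T s"
      by (rule nn_integral_multc) measurable
    also have "(\<integral>\<^sup>+f. ennreal (R f) * indicator {f. R f \<le> \<rho> s} f \<partial>?M I) = ennreal (unit_ball_vol m * m / (m + 1) * \<rho> s ^ (m + 1))"
      using nn_integral_norm_over_ball_PiM[OF fin \<rho>[of s]] unfolding R_def card .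
    also have "\<dots> = ?C * ennreal (\<rho> s ^ DIM('a))"
      unfolding m(2) by (rule ennreal_mult) (use \<rho>[of s] in auto)
    finally show "(\<integral>\<^sup>+f. ennreal (R f) * indicator {f. R f \<le> \<rho> s} f * indicator ?T s \<partial>?M I)
       = ?C * (ennreal (\<rho> s ^ DIM('a)) * indicator ?T s)" by (simp add: mult.assoc)
  qed
  also have "\<dots> = ?C * (\<integral>\<^sup>+s. ennreal (\<rho> s ^ DIM('a)) * indicator ?T s \<partial>lborel)"
    by (rule nn_integral_cmult) measurable
  finally show ?thesis by (simp add: \<rho>_def)
qed

section \<open>The one-dimensional marginal of the uniform law\<close>

lemma absolutely_integrable_inverse_1_plus_square:
  "(\<lambda>s::real. inverse (1 + s\<^sup>2)) absolutely_integrable_on UNIV"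
proof -
  have "integrable lborel (\<lambda>s::real. inverse (1 + s\<^sup>2))"
    using integrable_inverse_1_plus_square by (simp add: set_integrable_def einterval_def)
  then show ?thesis
    unfolding set_integrable_def by (subst integrable_completion) auto
qed

text \<open>Up to normalization, the density of the scalar product of a uniform random point of the unit sphere
of \<open>d\<close>-dimensional space with a fixed unit vector.\<close>

definition marginal_weight :: "nat \<Rightarrow> real \<Rightarrow> real" where
  "marginal_weight d u = (1 - u\<^sup>2) powr ((real d - 3) / 2)"

lemma marginal_weight_measurable [measurable]: "marginal_weight d \<in> borel_measurable borel"
  unfolding marginal_weight_def by measurable

text \<open>The map \<open>u \<mapsto> u / sqrt (1 - u\<^sup>2)\<close> takes the cosine of an angle to its cotangent; its inverse is
\<open>s \<mapsto> s / sqrt (1 + s\<^sup>2)\<close>. The values \<open>t = 1\<close> and \<open>t = -1\<close> give the whole line and the empty set.\<close>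

lemma cosine_to_cotangent_image:
  fixes t :: real
  assumes t: "-1 \<le> t" "t \<le> 1"
  shows "(\<lambda>u. u / sqrt (1 - u\<^sup>2)) ` {-1<..<t} = {s. s < t * sqrt (1 + s\<^sup>2)}"
proof (intro equalityI subsetI)
  fix s assume "s \<in> (\<lambda>u. u / sqrt (1 - u\<^sup>2)) ` {-1<..<t}"
  then obtain u where u: "-1 < u" "u < t" and s: "s = u / sqrt (1 - u\<^sup>2)" by auto
  have p: "1 - u\<^sup>2 > 0" using u t by (simp add: abs_square_less_1 abs_less_iff)
  have "1 + s\<^sup>2 = 1 / (1 - u\<^sup>2)" using p unfolding s by (simp add: power_divide field_simps)
  then have "sqrt (1 + s\<^sup>2) = 1 / sqrt (1 - u\<^sup>2)" by (simp add: real_sqrt_divide)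
  then show "s \<in> {s. s < t * sqrt (1 + s\<^sup>2)}"
    using u p by (simp add: s divide_strict_right_mono)
next
  fix s assume "s \<in> {s. s < t * sqrt (1 + s\<^sup>2)}"
  then have s: "s < t * sqrt (1 + s\<^sup>2)" by simp
  define u where "u = s / sqrt (1 + s\<^sup>2)"
  have q: "1 + s\<^sup>2 > 0" by (simp add: add_pos_nonneg)
  have "1 - u\<^sup>2 = 1 / (1 + s\<^sup>2)" using q unfolding u_def by (simp add: power_divide field_simps)
  then have "sqrt (1 - u\<^sup>2) = 1 / sqrt (1 + s\<^sup>2)" by (simp add: real_sqrt_divide)
  then have "s = u / sqrt (1 - u\<^sup>2)" using q by (simp add: u_def)
  moreover have "u < t" using s q by (simp add: u_def pos_divide_less_eq)
  moreover have "-1 < u"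
  proof -
    have "\<bar>s\<bar> < sqrt (1 + s\<^sup>2)" by (rule real_less_rsqrt) simp
    then show ?thesis using q by (simp add: u_def pos_less_divide_eq)
  qed
  ultimately show "s \<in> (\<lambda>u. u / sqrt (1 - u\<^sup>2)) ` {-1<..<t}" by auto
qed

text \<open>With \<open>s = u / sqrt (1 - u\<^sup>2)\<close> one has \<open>1 + s\<^sup>2 = 1 / (1 - u\<^sup>2)\<close>, and the derivative of \<open>s\<close> is the power
\<open>-3 / 2\<close> of \<open>1 - u\<^sup>2\<close>; multiplied by the power \<open>d / 2\<close> coming from the integrand this is the weight.
The weight may be unbounded at the end points (if \<open>d = 2\<close>), so its integrability is
inherited from that of the integrand in \<open>s\<close>, which is at most \<open>1 / (1 + s\<^sup>2)\<close>.\<close>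

lemma
  fixes t :: real
  assumes d: "d \<ge> 2" and t: "-1 \<le> t" "t \<le> 1"
  shows set_integrable_marginal_weight: "set_integrable lborel {-1..t} (marginal_weight d)"
    and nn_integral_cotangent_substitution: "(\<integral>\<^sup>+s. ennreal ((1 / sqrt (1 + s\<^sup>2)) ^ d) * indicator {s. s < t * sqrt (1 + s\<^sup>2)} s \<partial>lborel)
      = ennreal (LBINT u:{-1..t}. marginal_weight d u)"
proof -
  let ?S = "{-1<..<t}" and ?T = "{s. s < t * sqrt (1 + s\<^sup>2)}"
  define g where "g u = u / sqrt (1 - u\<^sup>2)" for u :: real
  define g' where "g' u = (1 - u\<^sup>2) powr (- 3 / 2)" for u :: real
  define f where "f s = (1 / sqrt (1 + s\<^sup>2)) ^ d" for s :: real
  have gS: "g ` ?S = ?T"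
    using cosine_to_cotangent_image[OF t] by (simp add: g_def[abs_def])
  have pos: "1 - u\<^sup>2 > 0" if "u \<in> ?S" for u
    using that t by (simp add: abs_square_less_1 abs_less_iff)
  have fg: "\<bar>g' u\<bar> * f (g u) = marginal_weight d u" if "u \<in> ?S" for u
  proof -
    note p = pos[OF that]
    have "1 + (g u)\<^sup>2 = 1 / (1 - u\<^sup>2)" using p unfolding g_def by (simp add: power_divide field_simps)
    then have "f (g u) = sqrt (1 - u\<^sup>2) ^ d" by (simp add: f_def real_sqrt_divide)
    also have "\<dots> = (1 - u\<^sup>2) powr (real d / 2)"
      using p by (simp add: powr_half_sqrt[symmetric] powr_realpow[symmetric] powr_powr)
    finally have "\<bar>g' u\<bar> * f (g u) = (1 - u\<^sup>2) powr (- 3 / 2) * (1 - u\<^sup>2) powr (real d / 2)" by (simp add: g'_def)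
    also have "\<dots> = marginal_weight d u"
      by (simp add: powr_add[symmetric] marginal_weight_def field_simps)
    finally show ?thesis .
  qed
  have der: "(g has_field_derivative g' u) (at u within ?S)" if "u \<in> ?S" for u
  proof -
    note p = pos[OF that]
    have "(g has_field_derivative (sqrt (1 - u\<^sup>2) - u * (- u / sqrt (1 - u\<^sup>2))) / (sqrt (1 - u\<^sup>2) * sqrt (1 - u\<^sup>2))) (at u within ?S)"
      unfolding g_def using p by (auto intro!: derivative_eq_intros simp: field_simps)
    also have "(sqrt (1 - u\<^sup>2) - u * (- u / sqrt (1 - u\<^sup>2))) / (sqrt (1 - u\<^sup>2) * sqrt (1 - u\<^sup>2)) = 1 / (sqrt (1 - u\<^sup>2)) ^ 3"
      using p by (simp add: field_simps power2_eq_square power3_eq_cube)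
    also have "\<dots> = g' u"
      using p by (simp add: g'_def powr_half_sqrt[symmetric] powr_realpow[symmetric] powr_powr powr_minus_divide)
    finally show ?thesis .
  qed
  have inj: "inj_on g ?S"
  proof (rule inj_on_inverseI)
    fix u assume "u \<in> ?S"
    note p = pos[OF this]
    have "1 + (g u)\<^sup>2 = 1 / (1 - u\<^sup>2)" using p unfolding g_def by (simp add: power_divide field_simps)
    then have "sqrt (1 + (g u)\<^sup>2) = 1 / sqrt (1 - u\<^sup>2)" by (simp add: real_sqrt_divide)
    then show "g u / sqrt (1 + (g u)\<^sup>2) = u" using p by (simp add: g_def)
  qed
  have [measurable]: "f \<in> borel_measurable borel" "?T \<in> sets borel" unfolding f_def by measurable
  have f0: "f s \<ge> 0" for s by (simp add: f_def)
  have "f s \<le> inverse (1 + s\<^sup>2)" for s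
  proof -
    have "sqrt (1 + s\<^sup>2) \<ge> 1" by simp
    then have "f s \<le> (1 / sqrt (1 + s\<^sup>2)) ^ 2"
      unfolding f_def using d by (intro power_decreasing) (simp_all add: divide_le_eq_1 add_pos_nonneg)
    also have "\<dots> = inverse (1 + s\<^sup>2)" by (simp add: power_divide inverse_eq_divide)
    finally show ?thesis .
  qed
  then have "f absolutely_integrable_on UNIV"
    using f0 by (intro set_integrable_bound[OF absolutely_integrable_inverse_1_plus_square])
      (auto simp: set_borel_measurable_def intro!: measurable_completion AE_I2)
  then have fT: "f absolutely_integrable_on ?T"
    by (rule set_integrable_subset) auto
  have sub: "(\<lambda>u. \<bar>g' u\<bar> * f (g u)) absolutely_integrable_on ?S \<and>
      integral ?S (\<lambda>u. \<bar>g' u\<bar> * f (g u)) = integral ?T f"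
    using has_absolute_integral_change_of_variables_1'[of ?S g g' f "integral ?T f"] der inj fT gS by simp
  have "marginal_weight d absolutely_integrable_on ?S"
    using sub fg by (metis (no_types, lifting) set_integrable_cong)
  then have wS: "set_integrable lborel ?S (marginal_weight d)"
    unfolding set_integrable_def by (subst (asm) integrable_completion) measurable
  have "set_integrable lborel {-1..t} (marginal_weight d) \<longleftrightarrow> set_integrable lborel ?S (marginal_weight d)"
    by (rule set_integrable_discrete_difference[where X = "{-1, t}"]) auto
  with wS show "set_integrable lborel {-1..t} (marginal_weight d)" by simp
  have "(LBINT u:{-1..t}. marginal_weight d u) = (LBINT u:?S. marginal_weight d u)"
    by (rule set_integral_discrete_difference[where X = "{-1, t}"]) auto
  also have "\<dots> = integral ?S (marginal_weight d)"
    using wS by (rule set_borel_integral_eq_integral)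
  also have "\<dots> = integral ?S (\<lambda>u. \<bar>g' u\<bar> * f (g u))"
    using fg by (intro integral_cong) simp
  also have "\<dots> = integral ?T f" using sub by simp
  finally have eq: "(LBINT u:{-1..t}. marginal_weight d u) = integral ?T f" .
  have "(f has_integral integral ?T f) ?T"
    using fT by (intro integrable_integral) (rule set_lebesgue_integral_eq_integral)
  then show "(\<integral>\<^sup>+s. ennreal ((1 / sqrt (1 + s\<^sup>2)) ^ d) * indicator ?T s \<partial>lborel)
      = ennreal (LBINT u:{-1..t}. marginal_weight d u)"
    unfolding eq using nn_integral_has_integral_lebesgue'[of ?T f] f0 by (simp add: f_def)
qed

text \<open>Positivity is only assumed in the open interval, where \<open>w\<close> is continuous; hence the integral over
\<open>{r..s}\<close> is compared with the one over its middle third, which stays away from the end points.\<close>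

lemma strict_mono_on_integral:
  fixes w :: "real \<Rightarrow> real"
  assumes int: "w integrable_on {a..b}" and cont: "continuous_on {a<..<b} w"
    and pos: "\<And>x. x \<in> {a<..<b} \<Longrightarrow> w x > 0" and nonneg: "\<And>x. x \<in> {a..b} \<Longrightarrow> w x \<ge> 0"
  shows "strict_mono_on {a..b} (\<lambda>t. integral {a..t} w)"
proof (rule strict_mono_onI)
  fix r s assume rs: "r \<in> {a..b}" "s \<in> {a..b}" "r < s"
  define r' s' where "r' = (2 * r + s) / 3" and "s' = (r + 2 * s) / 3"
  have ord: "a \<le> r" "r < r'" "r' < s'" "s' < s" "s \<le> b"
    using rs by (auto simp: r'_def s'_def)
  have sub: "w integrable_on {x..y}" if "a \<le> x" "y \<le> b" for x y
    using that by (intro integrable_on_subinterval[OF int]) auto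
  have "integral {r'..s'} w \<noteq> 0"
  proof
    assume "integral {r'..s'} w = 0"
    moreover have "continuous_on {r'..s'} w"
      using cont by (rule continuous_on_subset) (use ord in auto)
    ultimately have "w r' = 0"
      using integral_eq_0_iff[of r' s' w] nonneg ord by auto
    then show False using pos[of r'] ord by auto
  qed
  moreover have "integral {r'..s'} w \<ge> 0"
    using nonneg ord by (intro integral_nonneg sub) auto
  moreover have "integral {r'..s'} w \<le> integral {r..s} w"
    using nonneg ord by (intro integral_subset_le sub) auto
  moreover have "integral {a..r} w + integral {r..s} w = integral {a..s} w"
    using ord by (intro Henstock_Kurzweil_Integration.integral_combine sub) auto
  ultimately show "integral {a..r} w < integral {a..s} w" by simp
qed

lemma
  assumes d: "d \<ge> 2"
  shows integral_marginal_weight_pos: "(LBINT s:{-1..1}. marginal_weight d s) > 0"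
    and continuous_on_F_star: "continuous_on {-1..1} (F_star d)"
    and strict_mono_on_F_star: "strict_mono_on {-1..1} (F_star d)"
    and F_star_minus_one: "F_star d (-1) = 0"
    and F_star_one: "F_star d 1 = 1"
    and F_star_eq: "F_star d t = (LBINT s:{-1..t}. marginal_weight d s) / (LBINT s:{-1..1}. marginal_weight d s)"
proof -
  let ?w = "marginal_weight d"
  define W where "W t = (LBINT s:{-1..t}. ?w s)" for t
  have F: "F_star d t = (LBINT s:{-1..t}. ?w s) / (LBINT s:{-1..1}. ?w s)" for t
    by (simp add: F_star_def marginal_weight_def)
  then show "F_star d t = (LBINT s:{-1..t}. ?w s) / (LBINT s:{-1..1}. ?w s)" .
  have W: "W t = integral {-1..t} ?w" if "t \<in> {-1..1}" for t
    unfolding W_def using that set_integrable_marginal_weight[OF d] by (intro set_borel_integral_eq_integral) auto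
  have int: "?w integrable_on {-1..1}"
    using set_integrable_marginal_weight[OF d] by (intro set_borel_integral_eq_integral(1)) auto
  have p: "1 - u\<^sup>2 > 0" if "u \<in> {-1<..<1}" for u :: real
    using that by (simp add: abs_square_less_1 abs_less_iff)
  have "strict_mono_on {-1..1} (\<lambda>t. integral {-1..t} ?w)"
  proof (rule strict_mono_on_integral[OF int])
    show "continuous_on {-1<..<1} ?w"
      unfolding marginal_weight_def using p by (intro continuous_intros) force+
    show "?w x > 0" if "x \<in> {-1<..<1}" for x
      using p[OF that] by (simp add: marginal_weight_def)
  qed (simp add: marginal_weight_def)
  then have mono: "strict_mono_on {-1..1} W"
    using W by (auto simp: strict_mono_on_def)
  have "continuous_on {-1..1} (\<lambda>t. integral {-1..t} ?w)"
    using int by (rule indefinite_integral_continuous_1)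
  then have cont: "continuous_on {-1..1} W"
    using W by (metis (no_types, lifting) continuous_on_cong)
  have 0: "W (-1) = 0" using W[of "-1"] by simp
  have 1: "W 1 > 0" using mono 0 by (auto dest: strict_mono_onD[of _ _ "-1" 1])
  then show "(LBINT s:{-1..1}. ?w s) > 0" by (simp add: W_def)
  have F': "F_star d = (\<lambda>t. W t / W 1)" using F by (auto simp: W_def)
  show "continuous_on {-1..1} (F_star d)"
    unfolding F' using cont 1 by (intro continuous_intros) auto
  show "strict_mono_on {-1..1} (F_star d)"
    unfolding F' using mono 1 by (auto simp: strict_mono_on_def divide_strict_right_mono)
  show "F_star d (-1) = 0" "F_star d 1 = 1" using 0 1 by (auto simp: F')
qed

text \<open>By rotation invariance of volume the axis may be assumed to be a coordinate axis.\<close>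

lemma emeasure_ball_cone:
  fixes e :: "real^'n"
  assumes d: "CARD('n) \<ge> 2" and e: "e \<in> usphere" and t: "-1 \<le> t" "t \<le> 1"
  defines "m \<equiv> CARD('n) - 1"
  shows "emeasure lborel {x \<in> cball 0 1. x \<bullet> e < t * norm x}
    = ennreal (unit_ball_vol m * m / (m + 1) * (LBINT s:{-1..t}. marginal_weight CARD('n) s))"
proof -
  obtain b :: "real^'n" where b: "b \<in> Basis" using nonempty_Basis by blast
  obtain f :: "real^'n \<Rightarrow> real^'n" where f: "orthogonal_transformation f" "f e = b"
    using orthogonal_transformation_exists_1[of e b] e b by auto
  have [measurable]: "f \<in> borel_measurable borel"
    using f(1) by (intro borel_measurable_continuous_onI linear_continuous_on)
      (simp add: linear_conv_bounded_linear[symmetric] orthogonal_transformation_linear)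
  let ?S = "\<lambda>v::real^'n. {x \<in> cball 0 1. x \<bullet> v < t * norm x}"
  have [measurable]: "?S b \<in> sets borel" by measurable
  have "f x \<bullet> b = x \<bullet> e" for x
    using f by (metis orthogonal_transformation_def)
  then have vim: "f -` ?S b = ?S e"
    using f(1) by (auto simp: orthogonal_transformation_norm)
  have "emeasure (distr lborel borel f) (?S b) = emeasure lborel (f -` ?S b \<inter> space lborel)"
    by (rule emeasure_distr) measurable
  then have "emeasure lborel (?S e) = emeasure (distr lborel borel f) (?S b)"
    unfolding vim by simp
  also have "\<dots> = emeasure lborel (?S b)"
    by (simp add: lborel_distr_orthogonal_transformation[OF f(1)])
  also have "\<dots> = ennreal (unit_ball_vol m * m / (m + 1)) * ennreal (LBINT s:{-1..t}. marginal_weight CARD('n) s)"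
    using emeasure_ball_cone_Basis[of b t] d b nn_integral_cotangent_substitution[OF d t] by (simp add: m_def)
  also have "\<dots> = ennreal (unit_ball_vol m * m / (m + 1) * (LBINT s:{-1..t}. marginal_weight CARD('n) s))"
    by (rule ennreal_mult[symmetric])
      (auto simp: set_lebesgue_integral_def marginal_weight_def intro!: integral_nonneg)
  finally show ?thesis .
qed

section \<open>The uniform law on the sphere\<close>

lemma sets_sphere_area [simp, measurable_cong]: "sets sphere_area = sets sphere_borel"
  by (simp add: sphere_area_def)

lemma sets_uniform_sphere [simp, measurable_cong]: "sets uniform_sphere = sets sphere_borel"
  by (simp add: uniform_sphere_def)

lemma space_sphere_borel [simp]: "space sphere_borel = usphere"
  by (simp add: sphere_borel_def space_restrict_space)

lemma space_uniform_sphere [simp]: "space uniform_sphere = usphere"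
  using sets_eq_imp_space_eq[OF sets_uniform_sphere] by simp

lemma continuous_on_measurable_sphere_borel:
  "continuous_on usphere X \<Longrightarrow> X \<in> borel_measurable sphere_borel"
  unfolding sphere_borel_def by (rule borel_measurable_continuous_on_restrict)

lemma continuous_on_measurable_sphere_borel_self:
  assumes "continuous_on usphere X" "X ` usphere \<subseteq> usphere"
  shows "X \<in> measurable sphere_borel sphere_borel"
  using continuous_on_measurable_sphere_borel[OF assms(1)] assms(2)
  unfolding sphere_borel_def by (intro measurable_restrict_space2) (auto simp: space_restrict_space)

text \<open>This is where surface area, a cone measure, meets the volume computation: the cone over the cap
\<open>{u \<in> usphere. u \<bullet> e < t}\<close> is the set \<open>{x \<in> cball 0 1. x \<bullet> e < t * norm x}\<close>. Its volume is a constant times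
the integral of the weight up to \<open>t\<close>, and for \<open>t = 1\<close> it fills the ball up to a ray, so that the
constant cancels in the quotient.\<close>

lemma measure_uniform_sphere_halfspace:
  fixes e :: "real^'n"
  assumes d: "CARD('n) \<ge> 2" and e: "e \<in> usphere" and t: "-1 \<le> t" "t \<le> 1"
  shows "measure uniform_sphere {u \<in> usphere. u \<bullet> e < t} = F_star CARD('n) t"
proof -
  define m where "m = CARD('n) - 1"
  define C where "C = unit_ball_vol m * m / (m + 1)"
  define W where "W t = (LBINT s:{-1..t}. marginal_weight CARD('n) s)" for t
  have C: "C > 0" using d by (auto simp: C_def m_def)
  have W0: "W t \<ge> 0" for t
    by (auto simp: W_def set_lebesgue_integral_def marginal_weight_def intro!: integral_nonneg)
  have W1: "W 1 > 0" using integral_marginal_weight_pos[OF d] by (simp add: W_def)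
  let ?cap = "{u \<in> usphere. u \<bullet> e < t}"
  have [measurable]: "(\<lambda>u. u \<bullet> e) \<in> borel_measurable sphere_borel"
    by (intro continuous_on_measurable_sphere_borel continuous_intros)
  have "{u \<in> space sphere_borel. u \<bullet> e < t} \<in> sets sphere_borel"
    by measurable
  then have meas: "?cap \<in> sets sphere_borel" by simp
  have top: "usphere \<in> sets (sphere_borel :: (real^'n) measure)"
    using sets.top[of "sphere_borel :: (real^'n) measure"] by simp
  have cone: "x \<in> {r *\<^sub>R x | r x. 0 < r \<and> r \<le> 1 \<and> x \<in> A} \<longleftrightarrow> x \<in> cball 0 1 - {0} \<and> x /\<^sub>R norm x \<in> A"
    if "A \<subseteq> usphere" for A and x :: "real^'n"
  proof
    assume "x \<in> {r *\<^sub>R x | r x. 0 < r \<and> r \<le> 1 \<and> x \<in> A}"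
    then show "x \<in> cball 0 1 - {0} \<and> x /\<^sub>R norm x \<in> A"
      using that by (auto simp: subset_iff)
  next
    assume x: "x \<in> cball 0 1 - {0} \<and> x /\<^sub>R norm x \<in> A"
    then have "x = norm x *\<^sub>R (x /\<^sub>R norm x)" "0 < norm x" "norm x \<le> 1" by auto
    with x show "x \<in> {r *\<^sub>R x | r x. 0 < r \<and> r \<le> 1 \<and> x \<in> A}" by blast
  qed
  have "{r *\<^sub>R x | r x. 0 < r \<and> r \<le> 1 \<and> x \<in> ?cap} = {x \<in> cball 0 1. x \<bullet> e < t * norm x}"
  proof (rule set_eqI)
    fix x :: "real^'n"
    show "x \<in> {r *\<^sub>R x | r x. 0 < r \<and> r \<le> 1 \<and> x \<in> ?cap} \<longleftrightarrow> x \<in> {x \<in> cball 0 1. x \<bullet> e < t * norm x}"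
      by (subst cone) (auto simp: field_simps)
  qed
  then have area: "emeasure sphere_area ?cap = of_nat CARD('n) * ennreal (C * W t)"
    using emeasure_sphere_area[OF meas] emeasure_ball_cone[OF d e t] by (simp add: C_def m_def W_def)
  have sphere_cone: "{r *\<^sub>R x | r x. 0 < r \<and> r \<le> 1 \<and> x \<in> usphere} = (cball 0 1 - {0} :: (real^'n) set)"
  proof (rule set_eqI)
    fix x :: "real^'n"
    show "x \<in> {r *\<^sub>R x | r x. 0 < r \<and> r \<le> 1 \<and> x \<in> usphere} \<longleftrightarrow> x \<in> cball 0 1 - {0}"
      by (subst cone) auto
  qed
  let ?B1 = "{x \<in> cball 0 1. x \<bullet> e < 1 * norm x}"
  have "dim {e} < DIM(real^'n)"
    using dim_le_card'[of "{e}"] d by simp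
  then have "negligible (span {e})"
    by (intro negligible_lowdim) (simp add: dim_span)
  then have null: "span {e} \<in> null_sets lborel"
    by (simp add: negligible_iff_null_sets null_sets_completion_iff closed_span)
  \<comment> \<open>By the equality case of the Cauchy-Schwarz inequality, only multiples of \<open>e\<close> can be missed.\<close>
  have "cball 0 1 - span {e} \<subseteq> ?B1"
  proof
    fix x assume x: "x \<in> cball 0 1 - span {e}"
    have "x \<bullet> e \<noteq> norm x"
    proof
      assume "x \<bullet> e = norm x"
      then have "norm x *\<^sub>R e = x"
        using e norm_cauchy_schwarz_eq[of x e] by simp
      then have "x \<in> span {e}" by (metis span_base span_scale singletonI)
      then show False using x by blast
    qed
    then show "x \<in> ?B1" using x e norm_cauchy_schwarz[of x e] by auto
  qed
  moreover have [measurable]: "?B1 \<in> sets lborel" by measurable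
  ultimately have "emeasure lborel (cball 0 1 - span {e}) \<le> emeasure lborel ?B1"
    by (intro emeasure_mono)
  moreover have "emeasure lborel ?B1 \<le> emeasure lborel (cball 0 1 :: (real^'n) set)"
    by (intro emeasure_mono) auto
  moreover have "emeasure lborel (cball 0 1 - span {e}) = emeasure lborel (cball 0 1 :: (real^'n) set)"
    using null by (intro emeasure_Diff_null_set) auto
  ultimately have "emeasure lborel (cball 0 1 :: (real^'n) set) = emeasure lborel ?B1" by simp
  moreover have "emeasure lborel (cball 0 1 - {0} :: (real^'n) set) = emeasure lborel (cball 0 1 :: (real^'n) set)"
    by (rule emeasure_Diff_null_set) (auto intro: null_setsI)
  ultimately have total: "emeasure sphere_area (usphere :: (real^'n) set) = of_nat CARD('n) * ennreal (C * W 1)"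
    using emeasure_sphere_area[OF top] emeasure_ball_cone[OF d e, of 1] sphere_cone by (simp add: C_def m_def W_def)
  have "emeasure uniform_sphere ?cap = emeasure sphere_area (usphere \<inter> ?cap) / emeasure sphere_area (usphere :: (real^'n) set)"
    unfolding uniform_sphere_def using meas top by (intro emeasure_uniform_measure) auto
  also have "usphere \<inter> ?cap = ?cap" by auto
  also have "emeasure sphere_area ?cap / emeasure sphere_area (usphere :: (real^'n) set)
      = ennreal (CARD('n) * (C * W t)) / ennreal (CARD('n) * (C * W 1))"
    unfolding area total ennreal_of_nat_eq_real_of_nat
    by (subst (1 2) ennreal_mult'[symmetric]) auto
  also have "\<dots> = ennreal (W t / W 1)"
    using C W0[of t] W1 d by (subst divide_ennreal) auto
  also have "W t / W 1 = F_star CARD('n) t"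
    using F_star_eq[OF d] by (simp add: W_def)
  finally have "emeasure uniform_sphere ?cap = ennreal (F_star CARD('n) t)" .
  moreover have "F_star CARD('n) t \<ge> 0"
    using W0[of t] W1 F_star_eq[OF d] by (simp add: W_def)
  ultimately show ?thesis by (simp add: measure_def)
qed

text \<open>The probability integral transform: \<open>F_star\<close> is the distribution function of \<open>u \<bullet> e\<close> and maps
\<open>{-1..1}\<close> continuously and strictly increasingly onto \<open>{0..1}\<close>.\<close>

lemma uniform_sphere_F_star_uniform:
  fixes e :: "real^'n"
  assumes d: "CARD('n) \<ge> 2" and e: "e \<in> usphere"
  shows "has_law uniform_sphere borel (\<lambda>u. F_star CARD('n) (u \<bullet> e)) (uniform_measure lborel {0..1})"
proof -
  let ?F = "F_star CARD('n)" and ?U = "uniform_sphere :: (real^'n) measure"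
  define X where "X u = ?F (u \<bullet> e)" for u
  note cont = continuous_on_F_star[OF d] and mono = strict_mono_on_F_star[OF d]
    and ends = F_star_minus_one[OF d] F_star_one[OF d]
  have rng: "u \<bullet> e \<in> {-1..1}" if "u \<in> usphere" for u
    using Cauchy_Schwarz_ineq2[of u e] that e by (auto simp: abs_le_iff)
  have "continuous_on usphere X"
    unfolding X_def by (rule continuous_on_compose2[OF cont]) (use rng in \<open>auto intro!: continuous_intros\<close>)
  then have [measurable]: "X \<in> borel_measurable ?U"
    using continuous_on_measurable_sphere_borel by (simp cong: measurable_cong_sets)
  interpret U: prob_space ?U by (rule prob_space_uniform_sphere)
  let ?N = "distr ?U borel X"
  interpret N: prob_space ?N by (rule U.prob_space_distr) simp
  interpret V: prob_space "uniform_measure lborel {0..1::real}"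
    by (rule prob_space_uniform_measure) auto
  have X01: "X u \<in> {0..1}" if "u \<in> usphere" for u
    using strict_mono_on_leD[OF mono, of "-1" "u \<bullet> e"] strict_mono_on_leD[OF mono, of "u \<bullet> e" 1] rng[OF that] ends
    by (auto simp: X_def)
  \<comment> \<open>The half-space formula gives the open half-lines directly; closed ones are then squeezed between them.\<close>
  have less: "measure ?N {..<\<tau>} = \<tau>" if \<tau>: "\<tau> \<in> {0..1}" for \<tau>
  proof -
    obtain t where t: "-1 \<le> t" "t \<le> 1" "?F t = \<tau>"
      using IVT'[of ?F "-1" \<tau> 1] \<tau> cont ends by auto
    have "measure ?N {..<\<tau>} = measure ?U {u \<in> usphere. X u < \<tau>}"
      by (subst measure_distr) (auto intro!: arg_cong[where f = "measure ?U"])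
    also have "{u \<in> usphere. X u < \<tau>} = {u \<in> usphere. u \<bullet> e < t}"
      using strict_mono_on_less[OF mono] rng t by (auto simp: X_def)
    also have "measure ?U \<dots> = \<tau>"
      using measure_uniform_sphere_halfspace[OF d e t(1,2)] t(3) by simp
    finally show ?thesis .
  qed
  have "cdf ?N x = cdf (uniform_measure lborel {0..1}) x" for x
  proof -
    have V: "cdf (uniform_measure lborel {0..1}) x = (if x < 0 then 0 else min x 1)"
    proof -
      have "{0..1} \<inter> {..x} = (if x < 0 then {} else {0..min x 1})" by auto
      then show ?thesis by (simp add: cdf_def min.commute)
    qed
    consider "x < 0" | "0 \<le> x" "x < 1" | "1 \<le> x" by linarith
    then show ?thesis
    proof cases
      case 1
      have "measure ?N {..x} \<le> measure ?N {..<0}" using 1 by (intro N.finite_measure_mono) auto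
      then show ?thesis using 1 less[of 0] measure_nonneg[of ?N "{..x}"] V by (simp add: cdf_def)
    next
      case 2
      have "measure ?N {..<x} \<le> measure ?N {..x}" by (intro N.finite_measure_mono) auto
      then have "x \<le> measure ?N {..x}" using less[of x] 2 by simp
      moreover have "measure ?N {..x} \<le> x"
      proof (rule dense_ge_bounded[OF 2(2)])
        fix y assume "x < y" "y < 1"
        then have "measure ?N {..x} \<le> measure ?N {..<y}" by (intro N.finite_measure_mono) auto
        then show "measure ?N {..x} \<le> y" using less[of y] 2 \<open>x < y\<close> \<open>y < 1\<close> by simp
      qed
      ultimately show ?thesis using 2 V by (simp add: cdf_def)
    next
      case 3
      have "measure ?N {..<1} \<le> measure ?N {..x}" using 3 by (intro N.finite_measure_mono) auto
      then have "measure ?N {..x} = 1" using less[of 1] N.prob_le_1[of "{..x}"] by simp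
      then show ?thesis using 3 V by (simp add: cdf_def)
    qed
  qed
  then have "?N = uniform_measure lborel {0..1}"
    by (intro cdf_unique real_distribution.intro real_distribution_axioms.intro ext N.prob_space_axioms V.prob_space_axioms) auto
  then have "has_law ?U borel X (uniform_measure lborel {0..1})"
    by (simp add: has_law_def)
  then show ?thesis unfolding X_def[abs_def] .
qed

section \<open>Spherical caps\<close>

text \<open>The cap is the union of the arcs that run from the points of its boundary to the pole \<open>e\<close> along meridians; all of them
contain \<open>e\<close>. The direction \<open>w\<close> of a meridian is determined by \<open>u\<close> except at the poles, where
any \<open>w\<close> orthogonal to \<open>e\<close> serves; such a \<open>w\<close> exists in dimension at least two.\<close>

lemma connected_spherical_cap:
  fixes e :: "'a::euclidean_space"
  assumes d: "DIM('a) \<ge> 2" and e: "norm e = 1" and t: "-1 \<le> t" "t \<le> 1"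
  shows "connected {u \<in> sphere 0 1. t \<le> u \<bullet> e}"
proof -
  define W where "W = {w \<in> sphere 0 1. w \<bullet> e = 0}"
  define arc where "arc w a = a *\<^sub>R e + sqrt (1 - a\<^sup>2) *\<^sub>R w" for w and a :: real
  have ee: "e \<bullet> e = 1" using e by (simp add: norm_eq_1)
  obtain y where y: "y \<noteq> 0" "orthogonal e y" using orthogonal_to_vector_exists[OF d] by blast
  then have w0: "y /\<^sub>R norm y \<in> W" by (simp add: W_def orthogonal_def inner_commute)
  have "{u \<in> sphere 0 1. t \<le> u \<bullet> e} = (\<Union>w\<in>W. arc w ` {t..1})"
  proof (intro equalityI subsetI)
    fix u assume u: "u \<in> {u \<in> sphere 0 1. t \<le> u \<bullet> e}"
    define a v where "a = u \<bullet> e" and "v = u - a *\<^sub>R e"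
    have uu: "u \<bullet> u = 1" using u by (simp add: norm_eq_1)
    have a: "a \<in> {t..1}" using u e norm_cauchy_schwarz[of u e] by (simp add: a_def)
    have "v \<bullet> v = 1 - a\<^sup>2"
      by (simp add: v_def inner_diff_left inner_diff_right uu ee a_def inner_commute power2_eq_square)
    then have nv: "norm v = sqrt (1 - a\<^sup>2)" by (simp add: norm_eq_sqrt_inner)
    show "u \<in> (\<Union>w\<in>W. arc w ` {t..1})"
    proof (cases "v = 0")
      case True
      then have "u = arc (y /\<^sub>R norm y) a" using nv by (simp add: arc_def v_def)
      then show ?thesis using w0 a by blast
    next
      case False
      then have "v /\<^sub>R norm v \<in> W"
        by (simp add: W_def v_def inner_diff_left ee a_def)
      moreover have "u = arc (v /\<^sub>R norm v) a" using False nv[symmetric] by (simp add: arc_def v_def)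
      ultimately show ?thesis using a by blast
    qed
  next
    fix u assume "u \<in> (\<Union>w\<in>W. arc w ` {t..1})"
    then obtain w a where w: "w \<bullet> w = 1" "w \<bullet> e = 0" and a: "t \<le> a" "a \<le> 1" and u: "u = arc w a"
      by (auto simp: W_def norm_eq_1)
    have "a\<^sup>2 \<le> 1" using a t by (simp add: abs_square_le_1 abs_le_iff)
    then have "u \<bullet> u = 1"
      using w ee by (simp add: u arc_def inner_add_left inner_add_right inner_commute power2_eq_square[symmetric])
    moreover have "u \<bullet> e = a" using w ee by (simp add: u arc_def inner_add_left)
    ultimately show "u \<in> {u \<in> sphere 0 1. t \<le> u \<bullet> e}" using a by (simp add: norm_eq_1)
  qed
  moreover have "connected (\<Union>w\<in>W. arc w ` {t..1})"
  proof (rule connected_Union)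
    fix s assume "s \<in> (\<lambda>w. arc w ` {t..1}) ` W"
    then obtain w where "s = arc w ` {t..1}" by auto
    moreover have "continuous_on {t..1} (arc w)" unfolding arc_def by (intro continuous_intros)
    ultimately show "connected s" by (simp add: connected_continuous_image)
  next
    have "e \<in> arc w ` {t..1}" for w
      using t by (intro image_eqI[where x = 1]) (auto simp: arc_def)
    then show "\<Inter>((\<lambda>w. arc w ` {t..1}) ` W) \<noteq> {}" by blast
  qed
  ultimately show ?thesis by simp
qed

section \<open>Transport by the directional distribution function\<close>

lemma has_law_comp:
  assumes "has_law M N X \<mu>" "has_law \<mu> K Y \<nu>"
  shows "has_law M K (\<lambda>\<omega>. Y (X \<omega>)) \<nu>"
proof -
  have X: "X \<in> measurable M N" and \<mu>: "distr M N X = \<mu>" using assms(1) by (auto simp: has_law_def)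
  have Y: "Y \<in> measurable N K" and \<nu>: "distr \<mu> K Y = \<nu>"
    using assms(2) by (auto simp: has_law_def \<mu>[symmetric])
  show ?thesis
    unfolding has_law_def using measurable_comp[OF X Y] distr_distr[OF Y X] by (simp add: comp_def \<mu> \<nu>)
qed

lemma sets_bounded_density_measures:
  assumes "P \<in> bounded_density_measures"
  shows "sets P = sets sphere_borel" "space P = usphere"
proof -
  show s: "sets P = sets sphere_borel"
    using assms by (auto simp: bounded_density_measures_def)
  show "space P = usphere" using sets_eq_imp_space_eq[OF s] by simp
qed

text \<open>Pushing the law \<open>P\<close> forward by \<open>F\<close> and then back by the inverse of \<open>F\<close> changes nothing.
Hence either function alone determines \<open>P\<close>.\<close>

lemma has_law_directional_quantile:
  assumes P: "P \<in> bounded_density_measures" and F: "directional_distribution_function P F"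
  shows "has_law uniform_sphere sphere_borel (directional_quantile F) P"
proof -
  note h = directional_quantile_homeomorphism[OF F]
  note P' = sets_bounded_density_measures[OF P]
  have F': "F \<in> measurable P sphere_borel" "distr P sphere_borel F = uniform_sphere"
    using F by (auto simp: directional_distribution_function_def optimal_map_def has_law_def)
  have Q: "directional_quantile F \<in> measurable sphere_borel sphere_borel"
    using h by (intro continuous_on_measurable_sphere_borel_self) (auto simp: homeomorphism_def)
  have "distr uniform_sphere sphere_borel (directional_quantile F) = distr P sphere_borel (directional_quantile F \<circ> F)"
    unfolding F'(2)[symmetric] using Q F'(1) by (rule distr_distr)
  also have "\<dots> = distr P P (\<lambda>z. z)"
    using h P' by (intro distr_cong) (auto simp: homeomorphism_def)
  also have "\<dots> = P" by simp
  finally show ?thesis using Q by (simp add: has_law_def cong: measurable_cong_sets)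
qed

lemma directional_quantile_determines_law:
  assumes "P \<in> bounded_density_measures" "directional_distribution_function P F"
    and "P' \<in> bounded_density_measures" "directional_distribution_function P' F'"
    and "\<And>u. u \<in> usphere \<Longrightarrow> directional_quantile F' u = directional_quantile F u"
  shows "P' = P"
proof -
  have "P' = distr uniform_sphere sphere_borel (directional_quantile F')"
    using has_law_directional_quantile[OF assms(3,4)] by (simp add: has_law_def)
  also have "\<dots> = distr uniform_sphere sphere_borel (directional_quantile F)"
    using assms(5) by (intro distr_cong) auto
  also have "\<dots> = P"
    using has_law_directional_quantile[OF assms(1,2)] by (simp add: has_law_def)
  finally show ?thesis .
qed

lemma directional_quantile_cong:
  assumes "\<And>z. z \<in> usphere \<Longrightarrow> F' z = F z"
  shows "directional_quantile F' u = directional_quantile F u"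
  unfolding directional_quantile_def inv_into_def
  using assms by (intro arg_cong[where f = Eps] ext) auto

theorem proposition3:
  fixes P :: "(real^'n) measure" and F :: "real^'n \<Rightarrow> real^'n" and \<theta> :: "real^'n"
    and M :: "'a measure" and Z :: "'a \<Rightarrow> real^'n"
  assumes "CARD('n) \<ge> 2"
    and "P \<in> bounded_density_measures"
    and "prob_space M" and "has_law M sphere_borel Z P"
    and "directional_distribution_function P F"
    and "\<theta> \<in> usphere"
  shows
    "((\<forall>P'\<in>bounded_density_measures. \<forall>F'. directional_distribution_function P' F' \<and>
         (\<forall>z\<in>usphere. F' z = F z) \<longrightarrow> P' = P) \<and>
      has_law M sphere_borel (\<lambda>\<omega>. F (Z \<omega>)) uniform_sphere \<and>
      has_law P sphere_borel F uniform_sphere \<and>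
      has_law M borel (\<lambda>\<omega>. F_star CARD('n) (F (Z \<omega>) \<bullet> F \<theta>)) (uniform_measure lborel {0..1}))
     \<and>
     ((\<forall>P'\<in>bounded_density_measures. \<forall>F'. directional_distribution_function P' F' \<and>
         (\<forall>u\<in>usphere. directional_quantile F' u = directional_quantile F u) \<longrightarrow> P' = P) \<and>
      (\<forall>(N :: 'b measure) U. prob_space N \<and> has_law N sphere_borel U uniform_sphere \<longrightarrow>
         has_law N sphere_borel (\<lambda>\<omega>. directional_quantile F (U \<omega>)) P) \<and>
      has_law uniform_sphere sphere_borel (directional_quantile F) P)
     \<and>
     ((\<forall>\<tau>\<in>{0..1}. continuous_on (uniform_contour F \<theta> \<tau>) (directional_quantile F) \<and>
         quantile_contour F \<theta> \<tau> = directional_quantile F ` uniform_contour F \<theta> \<tau>) \<and>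
      (\<forall>\<tau>\<in>{0..1}. closed (quantile_region F \<theta> \<tau>) \<and> connected (quantile_region F \<theta> \<tau>)) \<and>
      (\<forall>\<tau>\<in>{0..1}. \<forall>\<tau>'\<in>{0..1}. \<tau> \<le> \<tau>' \<longrightarrow>
         quantile_region F \<theta> \<tau> \<subseteq> quantile_region F \<theta> \<tau>') \<and>
      (\<Inter>\<tau>\<in>{0..1}. quantile_region F \<theta> \<tau>) = {\<theta>})
     \<and>
     (\<forall>\<tau>\<in>{0..1}. measure P (quantile_region F \<theta> \<tau>) = \<tau>)"
proof -
  note d = assms(1) and P = assms(2) and Z = assms(4) and F = assms(5) and \<theta> = assms(6)
  let ?Q = "directional_quantile F" and ?Fs = "F_star CARD('n)" and ?e = "F \<theta>"
  note h = directional_quantile_homeomorphism[OF F]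
  note cont = continuous_on_F_star[OF d] and mono = strict_mono_on_F_star[OF d]
    and ends = F_star_minus_one[OF d] F_star_one[OF d]
  have contQ: "continuous_on usphere ?Q" and Q_im: "?Q ` usphere = usphere" and QF: "\<And>z. z \<in> usphere \<Longrightarrow> ?Q (F z) = z"
    using h by (auto simp: homeomorphism_def)
  have e: "?e \<in> usphere" using h \<theta> by (auto simp: homeomorphism_def)
  have F_sph: "F z \<in> usphere" if "z \<in> usphere" for z using h that by (auto simp: homeomorphism_def)
  have rng: "u \<bullet> ?e \<in> {-1..1}" if "u \<in> usphere" for u
    using Cauchy_Schwarz_ineq2[of u ?e] that e by (auto simp: abs_le_iff)
  have lawF: "has_law P sphere_borel F uniform_sphere"
    using F by (simp add: directional_distribution_function_def optimal_map_def)
  have lawQ: "has_law uniform_sphere sphere_borel ?Q P"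
    by (rule has_law_directional_quantile[OF P F])
  have lawX: "has_law P borel (\<lambda>z. ?Fs (F z \<bullet> ?e)) (uniform_measure lborel {0..1})"
    by (rule has_law_comp[OF lawF uniform_sphere_F_star_uniform[OF d e]])
  \<comment> \<open>Monotonicity and surjectivity of \<open>F_star\<close> turn regions of the uniform law into caps about the image of the pole.\<close>
  have cap: "\<exists>t\<in>{-1..1}. uniform_region F \<theta> \<tau> = {u \<in> usphere. t \<le> u \<bullet> ?e}" if \<tau>: "\<tau> \<in> {0..1}" for \<tau>
  proof -
    obtain t where t: "-1 \<le> t" "t \<le> 1" "?Fs t = 1 - \<tau>"
      using IVT'[of ?Fs "-1" "1 - \<tau>" 1] \<tau> cont ends by auto
    then have "uniform_region F \<theta> \<tau> = {u \<in> usphere. t \<le> u \<bullet> ?e}"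
      unfolding uniform_region_def using strict_mono_on_less_eq[OF mono, of t] rng by auto
    then show ?thesis using t by auto
  qed
  have region: "closed (quantile_region F \<theta> \<tau>) \<and> connected (quantile_region F \<theta> \<tau>)" if \<tau>: "\<tau> \<in> {0..1}" for \<tau>
  proof -
    obtain t where t: "-1 \<le> t" "t \<le> 1" and eq: "uniform_region F \<theta> \<tau> = {u \<in> usphere. t \<le> u \<bullet> ?e}"
      using cap[OF \<tau>] by auto
    have contR: "continuous_on (uniform_region F \<theta> \<tau>) ?Q"
      using contQ by (rule continuous_on_subset) (auto simp: eq)
    have "uniform_region F \<theta> \<tau> = usphere \<inter> {u. t \<le> u \<bullet> ?e}" by (auto simp: eq)
    moreover have "closed {u. t \<le> u \<bullet> ?e}"
      by (intro closed_Collect_le continuous_intros)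
    ultimately have "compact (uniform_region F \<theta> \<tau>)"
      by (simp add: compact_Int_closed)
    moreover have "connected (uniform_region F \<theta> \<tau>)"
      unfolding eq using connected_spherical_cap[of ?e t] d e t by simp
    ultimately show ?thesis
      unfolding quantile_region_def using contR
      by (auto intro: compact_imp_closed compact_continuous_image connected_continuous_image)
  qed
  have inter: "(\<Inter>\<tau>\<in>{0..1}. quantile_region F \<theta> \<tau>) = {\<theta>}"
  proof (intro equalityI subsetI)
    fix z assume z: "z \<in> (\<Inter>\<tau>\<in>{0..1}. quantile_region F \<theta> \<tau>)"
    then have "z \<in> quantile_region F \<theta> 0" by auto
    then have zs: "z \<in> usphere" and "?Fs (F z \<bullet> ?e) \<ge> ?Fs 1"
      using ends(2) by (auto simp: quantile_region_eq[OF F])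
    then have "F z \<bullet> ?e \<ge> 1"
      using strict_mono_on_less_eq[OF mono, of 1 "F z \<bullet> ?e"] rng[OF F_sph[OF zs]] by auto
    \<comment> \<open>In the region of order zero the scalar product is maximal, so Cauchy-Schwarz holds with equality.\<close>
    then have "F z \<bullet> ?e = norm (F z) * norm ?e" using rng[OF F_sph[OF zs]] F_sph[OF zs] e by simp
    then have "F z = ?e" using norm_cauchy_schwarz_eq[of "F z" ?e] F_sph[OF zs] e by simp
    then show "z \<in> {\<theta>}" using QF[OF zs] QF[OF \<theta>] by (metis singletonI)
  next
    fix z assume "z \<in> {\<theta>}"
    moreover have "?e \<bullet> ?e = 1" using e by (simp add: norm_eq_1)
    ultimately show "z \<in> (\<Inter>\<tau>\<in>{0..1}. quantile_region F \<theta> \<tau>)"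
      using \<theta> ends(2) by (auto simp: quantile_region_eq[OF F])
  qed
  have content: "measure P (quantile_region F \<theta> \<tau>) = \<tau>" if \<tau>: "\<tau> \<in> {0..1}" for \<tau>
  proof -
    have "measure P (quantile_region F \<theta> \<tau>) = measure (distr P borel (\<lambda>z. ?Fs (F z \<bullet> ?e))) {1 - \<tau>..}"
    proof -
      have "(\<lambda>z. ?Fs (F z \<bullet> ?e)) -` {1 - \<tau>..} \<inter> space P = quantile_region F \<theta> \<tau>"
        unfolding quantile_region_eq[OF F] sets_bounded_density_measures(2)[OF P] by auto
      moreover have "(\<lambda>z. ?Fs (F z \<bullet> ?e)) \<in> borel_measurable P"
        using lawX by (simp only: has_law_def)
      ultimately show ?thesis using measure_distr[of _ P borel "{1 - \<tau>..}"] by simp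
    qed
    also have "\<dots> = measure (uniform_measure lborel {0..1}) {1 - \<tau>..}"
      using lawX by (simp only: has_law_def)
    also have "\<dots> = \<tau>"
    proof -
      have "{0..1} \<inter> {1 - \<tau>..} = {1 - \<tau>..1}" using \<tau> by auto
      then show ?thesis using \<tau> by simp
    qed
    finally show ?thesis .
  qed
  show ?thesis
  proof (intro conjI ballI allI impI)
    show "P' = P" if "P' \<in> bounded_density_measures"
      "directional_distribution_function P' F' \<and> (\<forall>z\<in>usphere. F' z = F z)" for P' F'
      using that by (intro directional_quantile_determines_law[OF P F, of P' F'] directional_quantile_cong) auto
    show "P' = P" if "P' \<in> bounded_density_measures"
      "directional_distribution_function P' F' \<and> (\<forall>u\<in>usphere. directional_quantile F' u = ?Q u)" for P' F'
      using directional_quantile_determines_law[OF P F] that by blast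
    show "has_law M sphere_borel (\<lambda>\<omega>. F (Z \<omega>)) uniform_sphere" by (rule has_law_comp[OF Z lawF])
    show "has_law M borel (\<lambda>\<omega>. ?Fs (F (Z \<omega>) \<bullet> ?e)) (uniform_measure lborel {0..1})"
      by (rule has_law_comp[OF Z lawX])
    show "has_law N sphere_borel (\<lambda>\<omega>. ?Q (U \<omega>)) P"
      if "prob_space N \<and> has_law N sphere_borel U uniform_sphere" for N :: "'b measure" and U
      using that lawQ by (blast intro: has_law_comp)
    show "continuous_on (uniform_contour F \<theta> \<tau>) ?Q" for \<tau>
      using contQ by (rule continuous_on_subset) (auto simp: uniform_contour_def)
    show "quantile_contour F \<theta> \<tau> = ?Q ` uniform_contour F \<theta> \<tau>" for \<tau>
      by (rule quantile_contour_def)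
    show "quantile_region F \<theta> \<tau> \<subseteq> quantile_region F \<theta> \<tau>'" if "\<tau> \<le> \<tau>'" for \<tau> \<tau>'
      using that by (auto simp: quantile_region_eq[OF F])
  qed (use lawF lawQ region inter content in auto)
qed

end
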